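(* Let $F_1,\dots,F_{12}$ be formulas of the propositional provability calculus such that, for each $i=1,\dots,12$, $F_i$ does not preserve the relation $R_i$ on $\mathfrak{B}_2$, where (with $\mathfrak{B}_2=\{\mathbb{0},\rho,\sigma,\mathbb{1}\}$): $R_1=\{\mathbb{0},\rho\}$, $R_2=\{\sigma,\mathbb{1}\}$, $R_3=\{\mathbb{0},\sigma\}$, $R_4=\{\mathbb{0},\mathbb{1}\}$, $R_5=\{\rho,\sigma\}$, $R_6=\{\rho,\mathbb{1}\}$, $R_7=\{\mathbb{0},\rho,\sigma\}$, $R_8=\{\mathbb{0},\rho,\mathbb{1}\}$, $R_9=\{\mathbb{0},\sigma,\mathbb{1}\}$, $R_{10}=\{\rho,\sigma,\mathbb{1}\}$ (unary relations), $R_{11}=\{(\mathbb{0},\rho),(\rho,\mathbb{0}),(\sigma,\mathbb{1}),(\mathbb{1},\sigma)\}$ and $R_{12}=\{(x,y):\Delta x\neq\Delta y\}=\{(\mathbb{0},\sigma),(\mathbb{0},\mathbb{1}),(\rho,\sigma),(\rho,\mathbb{1}),(\sigma,\mathbb{0}),(\sigma,\rho),(\mathbb{1},\mathbb{0}),(\mathbb{1},\rho)\}$ (binary relations). Then each of the constants $0,\rho,\sigma,1$ is expressible in the logic $L\mathfrak{B}_2$ via the formulas $F_1,\dots,F_{12}$.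
   Context: Formulas of the propositional provability calculus are built from propositional variables using $\&,\vee,\supset,\neg$ and the unary modal connective $\Delta$. The constant formulas $p\&\neg p$, $p\supset p$, $\Delta(p\&\neg p)$, $\neg\Delta(p\&\neg p)$ are denoted $0,1,\sigma,\rho$. The algebra $\mathfrak{B}_2=(\{\mathbb{0},\rho,\sigma,\mathbb{1}\};\&,\vee,\supset,\neg,\Delta)$ is the four-element Boolean algebra with least element $\mathbb{0}$, greatest element $\mathbb{1}$ and atoms $\rho,\sigma$ (so $\neg\rho=\sigma$), with usual Boolean operations and $\Delta\mathbb{0}=\Delta\rho=\sigma$, $\Delta\sigma=\Delta\mathbb{1}=\mathbb{1}$; the constant formulas $0,\rho,\sigma,1$ take the values $\mathbb{0},\rho,\sigma,\mathbb{1}$ respectively. $F[\alpha_1,\dots,\alpha_n]$ is the value of $F(p_1,\dots,p_n)$ on $\mathfrak{B}_2$ when $p_i$ takes value $\alpha_i$. $L\mathfrak{B}_2$ is the set of formulas taking value $\mathbb{1}$ under every evaluation on $\mathfrak{B}_2$; $A,B$ are equivalent in $L\mathfrak{B}_2$ if $(A\supset B)\&(B\supset A)\in L\mathfrak{B}_2$. A formula $F$ preserves an $m$-ary relation $R\subseteq\mathfrak{B}_2^m$ if for all $\alpha_{jk}\in\mathfrak{B}_2$ ($j=1,\dots,m$, $k=1,\dots,n$) such that $(\alpha_{1k},\dots,\alpha_{mk})\in R$ for every $k$, one has $(F[\alpha_{11},\dots,\alpha_{1n}],\dots,F[\alpha_{m1},\dots,\alpha_{mn}])\in R$. A formula $F$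 is expressible via a set of formulas $\Sigma$ in $L\mathfrak{B}_2$ if it belongs to the smallest set of formulas containing all propositional variables and all formulas of $\Sigma$ and closed under (a) weak substitution: from $A$ and $B$ obtain $A[p/B]$ (the result of substituting $B$ for a variable $p$ in $A$), and (b) replacement: from $A$ obtain any $B$ equivalent to $A$ in $L\mathfrak{B}_2$. A constant $c\in\{0,\rho,\sigma,1\}$ is expressible if some formula equivalent in $L\mathfrak{B}_2$ to the constant formula $c$ is expressible. *)

theory Defs
  imports Main
begin

datatype form =
    Var nat
  | Conj form form
  | Disj form form
  | Imp form form
  | Neg form
  | Delta form

datatype b2 = Zero | Rho | Sigma | One

text \<open>The order with least element \<^const>\<open>Zero\<close>, greatest element \<^const>\<open>One\<close> and incomparable
  \<^const>\<open>Rho\<close>, \<^const>\<open>Sigma\<close> makes \<^typ>\<open>b2\<close> the four-element Boolean algebra.\<close>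

instantiation b2 :: boolean_algebra
begin

definition bot_b2 :: b2 where "bot_b2 = Zero"

definition top_b2 :: b2 where "top_b2 = One"

definition less_eq_b2 :: "b2 \<Rightarrow> b2 \<Rightarrow> bool" where
  "x \<le> y \<longleftrightarrow> x = Zero \<or> x = y \<or> y = One"

definition less_b2 :: "b2 \<Rightarrow> b2 \<Rightarrow> bool" where
  "x < y \<longleftrightarrow> x \<le> y \<and> x \<noteq> (y :: b2)"

definition inf_b2 :: "b2 \<Rightarrow> b2 \<Rightarrow> b2" where
  "inf_b2 x y = (if x \<le> y then x else if y \<le> x then y else Zero)"

definition sup_b2 :: "b2 \<Rightarrow> b2 \<Rightarrow> b2" where
  "sup_b2 x y = (if x \<le> y then y else if y \<le> x then x else One)"

fun uminus_b2 :: "b2 \<Rightarrow> b2" where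
  "uminus_b2 Zero = One"
| "uminus_b2 Rho = Sigma"
| "uminus_b2 Sigma = Rho"
| "uminus_b2 One = Zero"

definition minus_b2 :: "b2 \<Rightarrow> b2 \<Rightarrow> b2" where
  "minus_b2 x y = inf x (- y)"

instance
proof
  fix x y z :: b2
  show "sup x (inf y z) = inf (sup x y) (sup x z)"
    by (cases x; cases y; cases z; simp add: inf_b2_def sup_b2_def less_eq_b2_def)
  show "inf x (- x) = bot"
    by (cases x; simp add: inf_b2_def bot_b2_def less_eq_b2_def)
  show "sup x (- x) = top"
    by (cases x; simp add: sup_b2_def top_b2_def less_eq_b2_def)
qed (auto simp: less_b2_def less_eq_b2_def inf_b2_def sup_b2_def bot_b2_def top_b2_def
      minus_b2_def)

end

fun delta :: "b2 \<Rightarrow> b2" where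
  "delta Zero = Sigma"
| "delta Rho = Sigma"
| "delta Sigma = One"
| "delta One = One"

primrec eval :: "(nat \<Rightarrow> b2) \<Rightarrow> form \<Rightarrow> b2" where
  "eval v (Var n) = v n"
| "eval v (Conj A B) = inf (eval v A) (eval v B)"
| "eval v (Disj A B) = sup (eval v A) (eval v B)"
| "eval v (Imp A B) = sup (- eval v A) (eval v B)"
| "eval v (Neg A) = - eval v A"
| "eval v (Delta A) = delta (eval v A)"

primrec vars :: "form \<Rightarrow> nat set" where
  "vars (Var n) = {n}"
| "vars (Conj A B) = vars A \<union> vars B"
| "vars (Disj A B) = vars A \<union> vars B"
| "vars (Imp A B) = vars A \<union> vars B"
| "vars (Neg A) = vars A"
| "vars (Delta A) = vars A"

primrec subst :: "form \<Rightarrow> nat \<Rightarrow> form \<Rightarrow> form" where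
  "subst (Var n) p C = (if n = p then C else Var n)"
| "subst (Conj A B) p C = Conj (subst A p C) (subst B p C)"
| "subst (Disj A B) p C = Disj (subst A p C) (subst B p C)"
| "subst (Imp A B) p C = Imp (subst A p C) (subst B p C)"
| "subst (Neg A) p C = Neg (subst A p C)"
| "subst (Delta A) p C = Delta (subst A p C)"

text \<open>The constant formulas, with \<^term>\<open>Var 0\<close> as the variable \<open>p\<close>; any other choice of
  variable yields equivalent formulas.\<close>

definition const0 :: form where "const0 = Conj (Var 0) (Neg (Var 0))"

definition const1 :: form where "const1 = Imp (Var 0) (Var 0)"

definition const_sigma :: form where "const_sigma = Delta const0"

definition const_rho :: form where "const_rho = Neg (Delta const0)"

lemma eval_const:
  "eval v const0 = Zero" "eval v const_rho = Rho"
  "eval v const_sigma = Sigma" "eval v const1 = One"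
proof -
  show *: "eval v const0 = Zero"
    unfolding const0_def by (simp flip: bot_b2_def)
  show "eval v const_sigma = Sigma" "eval v const_rho = Rho"
    by (simp_all add: const_sigma_def const_rho_def *)
  show "eval v const1 = One"
    unfolding const1_def by (simp flip: top_b2_def)
qed

definition LB2 :: "form set" where
  "LB2 = {A. \<forall>v. eval v A = One}"

definition equivalent :: "form \<Rightarrow> form \<Rightarrow> bool" where
  "equivalent A B \<longleftrightarrow> Conj (Imp A B) (Imp B A) \<in> LB2"

text \<open>An \<open>m\<close>-ary relation is a set of lists of length \<open>m\<close>. In \<open>\<alpha> j k\<close>, \<open>j\<close> is the position in
  the tuple and \<open>k\<close> the variable of \<open>F\<close>; values of \<open>\<alpha> j\<close> outside \<open>vars F\<close> are irrelevant.\<close>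

definition preserves :: "nat \<Rightarrow> b2 list set \<Rightarrow> form \<Rightarrow> bool" where
  "preserves m R F \<longleftrightarrow>
    (\<forall>\<alpha> :: nat \<Rightarrow> nat \<Rightarrow> b2.
      (\<forall>k \<in> vars F. map (\<lambda>j. \<alpha> j k) [0..<m] \<in> R) \<longrightarrow>
      map (\<lambda>j. eval (\<alpha> j) F) [0..<m] \<in> R)"

inductive_set expressible :: "form set \<Rightarrow> form set" for \<Sigma> :: "form set" where
  var: "Var n \<in> expressible \<Sigma>"
| base: "A \<in> \<Sigma> \<Longrightarrow> A \<in> expressible \<Sigma>"
| weak_subst: "A \<in> expressible \<Sigma> \<Longrightarrow> B \<in> expressible \<Sigma> \<Longrightarrow> subst A p B \<in> expressible \<Sigma>"
| replacement: "A \<in> expressible \<Sigma> \<Longrightarrow> equivalent A B \<Longrightarrow> B \<in> expressible \<Sigma>"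

definition const_expressible :: "form set \<Rightarrow> form \<Rightarrow> bool" where
  "const_expressible \<Sigma> c \<longleftrightarrow> (\<exists>A. equivalent A c \<and> A \<in> expressible \<Sigma>)"

lemma delta_neq_relation:
  "{[x, y] | x y. delta x \<noteq> delta y} =
    {[Zero, Sigma], [Zero, One], [Rho, Sigma], [Rho, One],
     [Sigma, Zero], [Sigma, Rho], [One, Zero], [One, Rho]}"
proof -
  have "delta x \<noteq> delta y \<longleftrightarrow>
    (x, y) \<in> {(Zero, Sigma), (Zero, One), (Rho, Sigma), (Rho, One),
     (Sigma, Zero), (Sigma, Rho), (One, Zero), (One, Rho)}" for x y
    by (cases x; cases y; simp)
  then show ?thesis by auto
qed

end

theory Submission
  imports Defs
begin

text \<open>
  Modulo the congruence \<open>delta x = delta y\<close>, with classes \<open>{Zero, Rho}\<close> and \<open>{Sigma, One}\<close>, every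
  formula is a Boolean function. There \<open>F 1\<close>, \<open>F 2\<close> and \<open>F 12\<close> violate the preservation of false, of
  true and of duality, so, as in Post's theorem, expressible unary maps into either class exist.
  Hence a nonempty subuniverse closed under all expressible unary maps meets both classes, and
  \<open>F 3\<close> to \<open>F 10\<close> force it to be the whole algebra. If no constant were expressible, all
  expressible unary maps would be injective on both classes; the values at \<open>Zero\<close> of these maps form
  such a subuniverse, so the pair \<open>(Zero, Rho)\<close> can be moved to every pair in the relation
  violated by \<open>F 11\<close>, and \<open>F 11\<close> then yields a map that is not injective on \<open>{Zero, Rho}\<close>. So
  some constant is expressible, and the expressible constants form such a subuniverse.
\<close>

section \<open>Evaluation and the congruence given by \<open>delta\<close>\<close>

lemma eval_cong: "(\<And>k. k \<in> vars A \<Longrightarrow> v k = w k) \<Longrightarrow> eval v A = eval w A"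
  by (induction A) simp_all

lemma eval_subst: "eval v (subst A p C) = eval (v(p := eval v C)) A"
  by (induction A) simp_all

lemma finite_vars: "finite (vars A)"
  by (induction A) simp_all

lemma delta_cases: "delta x = Sigma \<or> delta x = One"
  by (cases x) simp_all

lemma delta_eq_Sigma: "delta x = Sigma \<longleftrightarrow> x = Zero \<or> x = Rho"
  by (cases x) simp_all

lemma delta_eq_One: "delta x = One \<longleftrightarrow> x = Sigma \<or> x = One"
  by (cases x) simp_all

lemma delta_inf: "delta (inf x y) = inf (delta x) (delta y)"
  by (cases x; cases y; simp add: inf_b2_def less_eq_b2_def)

lemma delta_sup: "delta (sup x y) = sup (delta x) (delta y)"
  by (cases x; cases y; simp add: sup_b2_def less_eq_b2_def)

text \<open>The values \<open>Sigma\<close> and \<open>One\<close> of \<open>delta\<close> form a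
  two-element Boolean algebra with bottom \<open>Sigma\<close>; the right-hand side is
  complementation there.\<close>

lemma delta_uminus: "delta (- x) = sup Sigma (- delta x)"
  by (cases x; simp add: sup_b2_def less_eq_b2_def)

lemma delta_eval_cong:
  "(\<And>k. delta (v k) = delta (w k)) \<Longrightarrow> delta (eval v A) = delta (eval w A)"
  by (induction A) (simp_all add: delta_inf delta_sup delta_uminus)

section \<open>Expressible unary maps\<close>

lemma equivalent_iff: "equivalent A B \<longleftrightarrow> (\<forall>v. eval v A = eval v B)"
proof -
  have "inf (sup (- x) y) (sup (- y) x) = One \<longleftrightarrow> x = y" for x y :: b2
    by (cases x; cases y; simp add: inf_b2_def sup_b2_def less_eq_b2_def)
  then show ?thesis
    by (simp add: equivalent_def LB2_def)
qed

text \<open>\<open>A\<close> may contain variables other than \<open>Var 0\<close>, provided its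
  value ignores them. Hence a constant map in this set amounts to an expressible constant.\<close>

definition unary :: "form set \<Rightarrow> (b2 \<Rightarrow> b2) set" where
  "unary \<Sigma> = {f. \<exists>A \<in> expressible \<Sigma>. \<forall>v. eval v A = f (v 0)}"

lemma unary_id: "(\<lambda>t. t) \<in> unary \<Sigma>"
  unfolding unary_def using expressible.var[of 0 \<Sigma>] by force

text \<open>Simultaneous substitution is reduced to weak substitutions, one variable at a time. It
  makes the values of unary maps at a fixed point a subuniverse for the expressible
  formulas.\<close>

lemma unary_eval:
  assumes A: "A \<in> expressible \<Sigma>" and w: "\<And>k. w k \<in> unary \<Sigma>"
  shows "(\<lambda>t. eval (\<lambda>k. w k t) A) \<in> unary \<Sigma>"
proof -
  from w obtain C where C: "\<And>k. C k \<in> expressible \<Sigma>" "\<And>k v. eval v (C k) = w k (v 0)"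
    unfolding unary_def mem_Collect_eq by metis
  obtain N where N: "\<forall>k \<in> vars A. k < N"
    using finite_vars[of A] finite_nat_set_iff_bounded by blast
  \<comment> \<open>The fresh variable \<open>N\<close> carries the argument, so that successive weak substitutions do not
    interfere with each other.\<close>
  have "\<exists>B \<in> expressible \<Sigma>. \<forall>v. eval v B = eval (\<lambda>k. if k < n then w k (v N) else v k) A"
    if "n \<le> N" for n
    using that
  proof (induction n)
    case 0
    then show ?case using A by auto
  next
    case (Suc n)
    then obtain B where B: "B \<in> expressible \<Sigma>"
      "\<And>v. eval v B = eval (\<lambda>k. if k < n then w k (v N) else v k) A"
      by auto
    define D where "D = subst (C n) 0 (Var N)"
    have "subst B n D \<in> expressible \<Sigma>"
      unfolding D_def using B(1) C(1) by (intro expressible.weak_subst expressible.var)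
    moreover have "eval v (subst B n D) = eval (\<lambda>k. if k < Suc n then w k (v N) else v k) A" for v
    proof -
      have "eval v D = w n (v N)"
        by (simp add: D_def eval_subst C(2))
      then show ?thesis
        using Suc.prems unfolding eval_subst B(2) by (intro eval_cong) (auto simp: less_Suc_eq)
    qed
    ultimately show ?case by blast
  qed
  then obtain B where B: "B \<in> expressible \<Sigma>"
    "\<And>v. eval v B = eval (\<lambda>k. if k < N then w k (v N) else v k) A"
    by blast
  have "subst B N (Var 0) \<in> expressible \<Sigma>"
    using B(1) by (intro expressible.weak_subst expressible.var)
  moreover have "eval v (subst B N (Var 0)) = eval (\<lambda>k. w k (v 0)) A" for v
    unfolding eval_subst B(2) using N by (intro eval_cong) simp
  ultimately show ?thesis
    unfolding unary_def by blast
qed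

lemma unary_comp:
  assumes "f \<in> unary \<Sigma>" "g \<in> unary \<Sigma>"
  shows "(\<lambda>t. f (g t)) \<in> unary \<Sigma>"
proof -
  from assms(1) obtain A where "A \<in> expressible \<Sigma>" "\<And>v. eval v A = f (v 0)"
    unfolding unary_def by blast
  then show ?thesis
    using unary_eval[of A \<Sigma> "\<lambda>_. g"] assms(2) by simp
qed

lemma const_expressibleI:
  assumes "(\<lambda>_. x) \<in> unary \<Sigma>" and "\<And>v. eval v c = x"
  shows "const_expressible \<Sigma> c"
  using assms unfolding const_expressible_def unary_def equivalent_iff by auto

section \<open>Preservation of relations\<close>

definition closed_under :: "form \<Rightarrow> b2 set \<Rightarrow> bool" where
  "closed_under A T \<longleftrightarrow> (\<forall>\<alpha>. (\<forall>k. \<alpha> k \<in> T) \<longrightarrow> eval \<alpha> A \<in> T)"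

lemma preserves_unaryI:
  assumes "closed_under A T" "T \<noteq> {}" "R = (\<lambda>x. [x]) ` T"
  shows "preserves 1 R A"
  unfolding preserves_def
proof (intro allI impI)
  fix \<alpha> :: "nat \<Rightarrow> nat \<Rightarrow> b2"
  assume \<alpha>: "\<forall>k \<in> vars A. map (\<lambda>j. \<alpha> j k) [0..<1] \<in> R"
  \<comment> \<open>\<open>preserves\<close> constrains only the variables in \<open>vars A\<close>;
    \<open>x\<close> serves as a default elsewhere.\<close>
  from assms(2) obtain x where x: "x \<in> T" by blast
  define \<beta> where "\<beta> k = (if k \<in> vars A then \<alpha> 0 k else x)" for k
  have "\<beta> k \<in> T" for k
    using \<alpha> x by (auto simp: \<beta>_def assms(3))
  then have "eval \<beta> A \<in> T"
    using assms(1) by (auto simp: closed_under_def)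
  moreover have "eval \<beta> A = eval (\<alpha> 0) A"
    by (rule eval_cong) (simp add: \<beta>_def)
  ultimately show "map (\<lambda>j. eval (\<alpha> j) A) [0..<1] \<in> R"
    by (simp add: assms(3))
qed

text \<open>The pair \<open>[x, y]\<close> fills the variables outside \<open>vars A\<close>, so
  that the relation holds at every index.\<close>

lemma not_preserves_binaryE:
  assumes "\<not> preserves 2 R A" "[x, y] \<in> R"
  obtains \<alpha> \<beta> where "\<And>k. [\<alpha> k, \<beta> k] \<in> R" "[eval \<alpha> A, eval \<beta> A] \<notin> R"
proof -
  from assms(1) obtain \<gamma> :: "nat \<Rightarrow> nat \<Rightarrow> b2" where \<gamma>: "\<forall>k \<in> vars A. [\<gamma> 0 k, \<gamma> 1 k] \<in> R"
    "[eval (\<gamma> 0) A, eval (\<gamma> 1) A] \<notin> R"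
    by (auto simp: preserves_def numeral_2_eq_2)
  define \<alpha> where "\<alpha> k = (if k \<in> vars A then \<gamma> 0 k else x)" for k
  define \<beta> where "\<beta> k = (if k \<in> vars A then \<gamma> 1 k else y)" for k
  have "eval \<alpha> A = eval (\<gamma> 0) A" "eval \<beta> A = eval (\<gamma> 1) A"
    by (auto simp: \<alpha>_def \<beta>_def intro!: eval_cong)
  moreover have "[\<alpha> k, \<beta> k] \<in> R" for k
    using \<gamma>(1) assms(2) by (simp add: \<alpha>_def \<beta>_def)
  ultimately show thesis
    using \<gamma>(2) that[of \<alpha> \<beta>] by simp
qed

section \<open>Reaching both classes\<close>

text \<open>A map into one class suffices, since composing with \<open>a\<close> or \<open>b\<close>
  yields the other. Either \<open>a\<close> is such a map, or it swaps the classes and, together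
  with the violation of duality by \<open>C\<close>, produces one.\<close>

lemma unary_constant_class:
  assumes A: "A \<in> expressible \<Sigma>" "\<not> preserves 1 {[Zero], [Rho]} A"
    and B: "B \<in> expressible \<Sigma>" "\<not> preserves 1 {[Sigma], [One]} B"
    and C: "C \<in> expressible \<Sigma>" "\<not> preserves 2 {[x, y] | x y. delta x \<noteq> delta y} C"
  shows "\<exists>f \<in> unary \<Sigma>. \<exists>g \<in> unary \<Sigma>. (\<forall>t. delta (f t) = Sigma) \<and> (\<forall>t. delta (g t) = One)"
proof -
  define a where "a t = eval (\<lambda>_. t) A" for t
  define b where "b t = eval (\<lambda>_. t) B" for t
  have a: "a \<in> unary \<Sigma>" and b: "b \<in> unary \<Sigma>"
    using unary_eval[OF A(1), of "\<lambda>_ t. t"] unary_eval[OF B(1), of "\<lambda>_ t. t"] unary_id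
    by (simp_all add: a_def[abs_def] b_def[abs_def])
  have a1: "delta (a t) = One" if "delta t = Sigma" for t
  proof -
    have "\<not> closed_under A {Zero, Rho}"
      using A(2) preserves_unaryI[of A "{Zero, Rho}"] by auto
    then obtain \<alpha> where \<alpha>: "\<forall>k. \<alpha> k \<in> {Zero, Rho}" "eval \<alpha> A \<notin> {Zero, Rho}"
      unfolding closed_under_def by blast
    have "delta (a t) = delta (eval \<alpha> A)"
      unfolding a_def using \<alpha>(1) that
      by (intro delta_eval_cong) (metis delta_eq_Sigma insertE singletonD)
    with \<alpha>(2) show ?thesis
      using delta_cases[of "eval \<alpha> A"] by (auto simp: delta_eq_Sigma)
  qed
  have b1: "delta (b t) = Sigma" if "delta t = One" for t
  proof -
    have "\<not> closed_under B {Sigma, One}"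
      using B(2) preserves_unaryI[of B "{Sigma, One}"] by auto
    then obtain \<alpha> where \<alpha>: "\<forall>k. \<alpha> k \<in> {Sigma, One}" "eval \<alpha> B \<notin> {Sigma, One}"
      unfolding closed_under_def by blast
    have "delta (b t) = delta (eval \<alpha> B)"
      unfolding b_def using \<alpha>(1) that
      by (intro delta_eval_cong) (metis delta_eq_One insertE singletonD)
    with \<alpha>(2) show ?thesis
      using delta_cases[of "eval \<alpha> B"] by (auto simp: delta_eq_One)
  qed
  have from_One: ?thesis if "g \<in> unary \<Sigma>" "\<And>t. delta (g t) = One" for g
    using unary_comp[OF b that(1)] that b1[OF that(2)] by (intro bexI conjI allI)
  have from_Sigma: ?thesis if "f \<in> unary \<Sigma>" "\<And>t. delta (f t) = Sigma" for f
    using unary_comp[OF a that(1)] that a1[OF that(2)] by (intro bexI conjI allI)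
  show ?thesis
  proof (cases "delta (a Sigma) = One")
    case True
    have "delta (a t) = One" for t
    proof (cases "delta t = Sigma")
      case False
      then have "delta (a t) = delta (a Sigma)"
        unfolding a_def using delta_cases[of t] by (intro delta_eval_cong) auto
      with True show ?thesis by simp
    qed (rule a1)
    with a show ?thesis by (rule from_One)
  next
    case False
    then have aS: "delta (a Sigma) = Sigma"
      using delta_cases by blast
    obtain \<alpha> \<beta> where \<alpha>\<beta>: "\<And>k. delta (\<alpha> k) \<noteq> delta (\<beta> k)" "delta (eval \<alpha> C) = delta (eval \<beta> C)"
      using not_preserves_binaryE[OF C(2), of Zero Sigma] by auto
    \<comment> \<open>Modulo \<open>delta\<close>, each \<open>w k\<close> moves the pair
      \<open>(Zero, Sigma)\<close> to \<open>(\<alpha> k, \<beta> k)\<close>: the identity does so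
      directly, and \<open>a\<close> does so by swapping the classes.\<close>
    define w where "w k = (if delta (\<alpha> k) = Sigma then (\<lambda>t. t) else a)" for k
    define h where "h t = eval (\<lambda>k. w k t) C" for t
    have h: "h \<in> unary \<Sigma>"
      unfolding h_def[abs_def] using a unary_id by (intro unary_eval[OF C(1)]) (simp add: w_def)
    have hZ: "delta (h Zero) = delta (eval \<alpha> C)"
      unfolding h_def
    proof (rule delta_eval_cong)
      show "delta (w k Zero) = delta (\<alpha> k)" for k
        using a1[of Zero] delta_cases[of "\<alpha> k"] by (auto simp: w_def)
    qed
    have hS: "delta (h Sigma) = delta (eval \<beta> C)"
      unfolding h_def
    proof (rule delta_eval_cong)
      show "delta (w k Sigma) = delta (\<beta> k)" for k
        using aS delta_cases[of "\<alpha> k"] delta_cases[of "\<beta> k"] \<alpha>\<beta>(1)[of k] by (auto simp: w_def)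
    qed
    have "delta (h t) = delta (h Zero)" for t
    proof (cases "delta t = Sigma")
      case True
      have "delta (w k t) = delta (w k Zero)" for k
        using True a1 by (simp add: w_def)
      then show ?thesis
        unfolding h_def by (rule delta_eval_cong)
    next
      case False
      then have "delta (a t) = delta (a Sigma)" "delta t = delta Sigma"
        unfolding a_def using delta_cases[of t] by (auto intro!: delta_eval_cong)
      then have "delta (h t) = delta (h Sigma)"
        unfolding h_def by (intro delta_eval_cong) (simp add: w_def)
      then show ?thesis
        using hZ hS \<alpha>\<beta>(2) by simp
    qed
    then show ?thesis
      using from_One[OF h] from_Sigma[OF h] delta_cases[of "h Zero"] by metis
  qed
qed

text \<open>Nonempty traces on the two classes leave nine subsets: \<open>UNIV\<close> and the eight
  excluded by the hypotheses on \<open>F 3\<close> to \<open>F 10\<close>.\<close>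

lemma subuniverse_meeting_both_classes:
  fixes F :: "nat \<Rightarrow> form"
  assumes closed: "\<And>i. i \<in> {1..12} \<Longrightarrow> closed_under (F i) T"
    and "\<not> preserves 1 {[Zero], [Sigma]} (F 3)"
    and "\<not> preserves 1 {[Zero], [One]} (F 4)"
    and "\<not> preserves 1 {[Rho], [Sigma]} (F 5)"
    and "\<not> preserves 1 {[Rho], [One]} (F 6)"
    and "\<not> preserves 1 {[Zero], [Rho], [Sigma]} (F 7)"
    and "\<not> preserves 1 {[Zero], [Rho], [One]} (F 8)"
    and "\<not> preserves 1 {[Zero], [Sigma], [One]} (F 9)"
    and "\<not> preserves 1 {[Rho], [Sigma], [One]} (F 10)"
    and x: "x \<in> T" "delta x = Sigma" and y: "y \<in> T" "delta y = One"
  shows "T = UNIV"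
proof -
  have all_b2: "(\<forall>z. P z) \<longleftrightarrow> P Zero \<and> P Rho \<and> P Sigma \<and> P One" for P :: "b2 \<Rightarrow> bool"
    by (metis b2.exhaust)
  have neq: "T \<noteq> S"
    if "i \<in> {1..12}" "S \<noteq> {}" "\<not> preserves 1 ((\<lambda>x. [x]) ` S) (F i)" for i S
    using that closed[of i] preserves_unaryI[of "F i" S] by blast
  have "T \<noteq> {Zero, Sigma}" "T \<noteq> {Zero, One}" "T \<noteq> {Rho, Sigma}" "T \<noteq> {Rho, One}"
    "T \<noteq> {Zero, Rho, Sigma}" "T \<noteq> {Zero, Rho, One}" "T \<noteq> {Zero, Sigma, One}"
    "T \<noteq> {Rho, Sigma, One}"
    using neq[of 3 "{Zero, Sigma}"] neq[of 4 "{Zero, One}"] neq[of 5 "{Rho, Sigma}"]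
      neq[of 6 "{Rho, One}"] neq[of 7 "{Zero, Rho, Sigma}"] neq[of 8 "{Zero, Rho, One}"]
      neq[of 9 "{Zero, Sigma, One}"] neq[of 10 "{Rho, Sigma, One}"] assms
    by simp_all
  then have "Zero \<in> T \<and> Rho \<in> T \<and> Sigma \<in> T \<and> One \<in> T"
    using x y unfolding set_eq_iff all_b2 delta_eq_Sigma delta_eq_One by auto
  then show ?thesis
    using b2.exhaust by (metis UNIV_eq_I)
qed

section \<open>Expressibility of the constants\<close>

theorem theorem2:
  fixes F :: "nat \<Rightarrow> form"
  assumes "\<not> preserves 1 {[Zero], [Rho]} (F 1)"
    and "\<not> preserves 1 {[Sigma], [One]} (F 2)"
    and "\<not> preserves 1 {[Zero], [Sigma]} (F 3)"
    and "\<not> preserves 1 {[Zero], [One]} (F 4)"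
    and "\<not> preserves 1 {[Rho], [Sigma]} (F 5)"
    and "\<not> preserves 1 {[Rho], [One]} (F 6)"
    and "\<not> preserves 1 {[Zero], [Rho], [Sigma]} (F 7)"
    and "\<not> preserves 1 {[Zero], [Rho], [One]} (F 8)"
    and "\<not> preserves 1 {[Zero], [Sigma], [One]} (F 9)"
    and "\<not> preserves 1 {[Rho], [Sigma], [One]} (F 10)"
    and "\<not> preserves 2 {[Zero, Rho], [Rho, Zero], [Sigma, One], [One, Sigma]} (F 11)"
    and "\<not> preserves 2 {[x, y] | x y. delta x \<noteq> delta y} (F 12)"
  shows "\<forall>c \<in> {const0, const_rho, const_sigma, const1}. const_expressible (F ` {1..12}) c"
proof -
  let ?\<Sigma> = "F ` {1..12}"
  have F: "F i \<in> expressible ?\<Sigma>" if "i \<in> {1..12}" for i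
    using that by (intro expressible.base) blast
  obtain f g where f: "f \<in> unary ?\<Sigma>" "\<And>t. delta (f t) = Sigma"
    and g: "g \<in> unary ?\<Sigma>" "\<And>t. delta (g t) = One"
    using unary_constant_class[OF F assms(1) F assms(2) F assms(12)] by auto
  have full: "T = UNIV" if closed: "\<And>i. i \<in> {1..12} \<Longrightarrow> closed_under (F i) T"
    and x: "x \<in> T" and T: "\<And>h t. h \<in> unary ?\<Sigma> \<Longrightarrow> t \<in> T \<Longrightarrow> h t \<in> T" for T x
    using subuniverse_meeting_both_classes[OF closed assms(3-10), of "f x" "g x"]
      T[OF f(1) x] T[OF g(1) x] f(2) g(2) by simp
  have "\<exists>x. (\<lambda>_. x) \<in> unary ?\<Sigma>"
  proof (rule ccontr)
    assume no_const: "\<nexists>x. (\<lambda>_. x) \<in> unary ?\<Sigma>"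
    \<comment> \<open>All values of \<open>f\<close> are \<open>Zero\<close> or \<open>Rho\<close>,
      so a map \<open>h\<close> that identifies these two would make \<open>h\<close> after
      \<open>f\<close> constant.\<close>
    have inj0: "h Zero \<noteq> h Rho" if "h \<in> unary ?\<Sigma>" for h
    proof
      assume "h Zero = h Rho"
      then have "(\<lambda>t. h (f t)) = (\<lambda>_. h Zero)"
        using f(2) by (metis delta_eq_Sigma)
      then show False
        using unary_comp[OF that f(1)] no_const by auto
    qed
    have T: "(\<lambda>h. h Zero) ` unary ?\<Sigma> = UNIV" (is "?T = _")
    proof (rule full)
      show "closed_under (F i) ?T" if "i \<in> {1..12}" for i
        unfolding closed_under_def
      proof (intro allI impI)
        fix \<alpha> :: "nat \<Rightarrow> b2"
        assume "\<forall>k. \<alpha> k \<in> ?T"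
        then obtain w where w: "\<And>k. w k \<in> unary ?\<Sigma>" "\<And>k. \<alpha> k = w k Zero"
          unfolding image_iff by metis
        then have "\<alpha> = (\<lambda>k. w k Zero)"
          by auto
        moreover have "(\<lambda>t. eval (\<lambda>k. w k t) (F i)) \<in> unary ?\<Sigma>"
          using F[OF that] w(1) by (rule unary_eval)
        ultimately show "eval \<alpha> (F i) \<in> ?T"
          by (auto intro!: image_eqI[of _ _ "\<lambda>t. eval (\<lambda>k. w k t) (F i)"])
      qed
      show "f Zero \<in> ?T"
        using f(1) by blast
      show "h t \<in> ?T" if h: "h \<in> unary ?\<Sigma>" and t: "t \<in> ?T" for h t
      proof -
        from t obtain h' where "h' \<in> unary ?\<Sigma>" "t = h' Zero"
          by blast
        then show ?thesis
          using unary_comp[OF h, of h'] by (auto intro!: image_eqI[of _ _ "\<lambda>s. h (h' s)"])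
      qed
    qed
    have "\<exists>h \<in> unary ?\<Sigma>. h Zero = x" for x
      using UNIV_I[of x] unfolding T[symmetric] by auto
    then obtain u where u: "\<And>x. u x \<in> unary ?\<Sigma>" "\<And>x. u x Zero = x"
      by metis
    obtain \<alpha> \<beta> where \<alpha>\<beta>:
      "\<And>k. [\<alpha> k, \<beta> k] \<in> {[Zero, Rho], [Rho, Zero], [Sigma, One], [One, Sigma]}"
      "[eval \<alpha> (F 11), eval \<beta> (F 11)] \<notin> {[Zero, Rho], [Rho, Zero], [Sigma, One], [One, Sigma]}"
      using not_preserves_binaryE[OF assms(11), of Zero Rho] by auto
    have same_class: "delta (h Zero) = delta (h Rho)" if h: "h \<in> unary ?\<Sigma>" for h
    proof -
      obtain A where A: "\<And>v. eval v A = h (v 0)"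
        using h unfolding unary_def by blast
      show ?thesis
        using delta_eval_cong[of "\<lambda>_. Zero" "\<lambda>_. Rho" A] by (simp add: A)
    qed
    \<comment> \<open>The relation for \<open>F 11\<close> pairs each element with the other element
      of its class. By \<open>inj0\<close> and \<open>same_class\<close>,
      \<open>u (\<alpha> k)\<close> sends \<open>Rho\<close> to the partner of
      \<open>\<alpha> k\<close>.\<close>
    have \<beta>: "\<beta> k = u (\<alpha> k) Rho" for k
      using \<alpha>\<beta>(1)[of k] u(2)[of "\<alpha> k"] inj0[OF u(1), of "\<alpha> k"] same_class[OF u(1), of "\<alpha> k"]
      by (cases "u (\<alpha> k) Rho") auto
    define h where "h t = eval (\<lambda>k. u (\<alpha> k) t) (F 11)" for t
    have h: "h \<in> unary ?\<Sigma>"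
      unfolding h_def[abs_def] by (rule unary_eval[OF F u(1)]) simp
    have "h Zero = eval \<alpha> (F 11)" "h Rho = eval \<beta> (F 11)"
      by (simp_all add: h_def u(2) flip: \<beta>)
    \<comment> \<open>Values in the same class that are not related must coincide, contradicting
      \<open>inj0\<close>.\<close>
    with \<alpha>\<beta>(2) show False
      using inj0[OF h] same_class[OF h] by (cases "h Zero"; cases "h Rho"; simp)
  qed
  then obtain x where x: "(\<lambda>_. x) \<in> unary ?\<Sigma>"
    by blast
  \<comment> \<open>One expressible constant makes this set nonempty, so \<open>full\<close> applies
    a second time.\<close>
  have "{x. (\<lambda>_. x) \<in> unary ?\<Sigma>} = UNIV" (is "?S = _")
  proof (rule full)
    show "closed_under (F i) ?S" if "i \<in> {1..12}" for i
      unfolding closed_under_def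
    proof (intro allI impI)
      fix \<alpha> :: "nat \<Rightarrow> b2"
      assume "\<forall>k. \<alpha> k \<in> ?S"
      then show "eval \<alpha> (F i) \<in> ?S"
        using unary_eval[OF F[OF that], of "\<lambda>k _. \<alpha> k"] by simp
    qed
    show "x \<in> ?S"
      using x by simp
    show "h t \<in> ?S" if "h \<in> unary ?\<Sigma>" "t \<in> ?S" for h t
      using that unary_comp[OF that(1), of "\<lambda>_. t"] by simp
  qed
  then have "(\<lambda>_. z) \<in> unary ?\<Sigma>" for z
    by (simp add: set_eq_iff)
  then have "const_expressible ?\<Sigma> c" if "\<And>v. eval v c = z" for c z
    using that by (rule const_expressibleI)
  then show ?thesis
    using eval_const by blast
qed

end
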